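(* Under the standing assumption on $E$, $x^*$, $x^{(0)}$ stated in the context (with constants $\delta,M,\mu,L$), suppose the initial point satisfies $$r_0=\|x^{(0)}-x^*\|_2<\min\{\delta,\hat r\},\qquad \hat r=\frac{2\mu}{M},$$ and $\beta_n=\frac{2}{L+\mu}$ for every $n\ge 0$. Then the iterates $$x^{(n+1)}=x^{(n)}-\beta_n\big(I-2v_1^{(n)}{v_1^{(n)}}^\top\big)\nabla E(x^{(n)})$$ converge to $x^*$ as $n\to\infty$, with $$r_n=\|x^{(n)}-x^*\|_2\le\left(1-\frac{2}{\kappa+3}\right)^n\frac{\hat r r_0}{\hat r-r_0}\quad\text{for all } n\ge 0,\qquad \kappa=\frac{L}{\mu}.$$
   Context: $E:\mathbb{R}^d\to\mathbb{R}$ is a twice differentiable function and $x^*$ is a non-degenerate index-1 saddle point of $E$: $\nabla E(x^* )=0$ and the Hessian $\nabla^2E(x^* )$ has exactly one negative eigenvalue and no zero eigenvalue. $\|\cdot\|_2$ denotes the Euclidean norm on vectors and the induced operator norm on matrices. Standing assumption: there is $\delta>0$ such that, with $U(x^*,\delta)=\{x:\|x-x^*\|_2<\delta\}$, the initial point satisfies $x^{(0)}\in U(x^*,\delta)$ and: (i) there is a constant $M>0$ with $\|\nabla^2E(x)-\nabla^2E(y)\|_2\le M\|x-y\|_2$ for all $x,y\in U(x^*,\delta)$; (ii) there are constants $0<\mu<L$ such that for every $x\in U(x^*,\delta)$ the eigenvalues of $\nabla^2E(x)$ satisfy $\lambda_1<0<\lambda_2\le\cdots\le\lambda_d$ and $|\lambda_i|\in[\mu,L]$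 for $1\le i\le d$. For each iterate $x^{(n)}$, $v_1^{(n)}$ is a unit eigenvector ($\|v_1^{(n)}\|_2=1$) of $\nabla^2E(x^{(n)})$ for its smallest eigenvalue. *)

theory Defs
  imports "HOL-Analysis.Analysis" "HOL-Computational_Algebra.Polynomial"
begin

definition grad :: "('a::euclidean_space \<Rightarrow> real) \<Rightarrow> 'a \<Rightarrow> 'a" where
  "grad E x = (THE D. GDERIV E x :> D)"

definition hess :: "(real^'n \<Rightarrow> real) \<Rightarrow> real^'n \<Rightarrow> real^'n^'n" where
  "hess E x = jacobian (grad E) (at x)"

definition twice_differentiable :: "(real^'n \<Rightarrow> real) \<Rightarrow> bool" where
  "twice_differentiable E \<longleftrightarrow>
     (\<forall>x. E differentiable (at x)) \<and> (\<forall>x. grad E differentiable (at x))"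

definition charpoly :: "real^'n^'n \<Rightarrow> real poly" where
  "charpoly A = det (\<chi> i j. (if i = j then [:0, 1:] else 0) - [:A $ i $ j:])"

text \<open>
  The real eigenvalues with algebraic multiplicity, in ascending order and indexed from 0, so
  that \<open>eigvals A ! 0\<close> is the smallest one, usually written \<open>\<lambda>\<^sub>1\<close>. For symmetric \<open>A\<close> (in particular for Hessians of twice differentiable functions) all
  eigenvalues are real, so the list has length \<open>CARD('n)\<close>.
\<close>

definition eigvals :: "real^'n^'n \<Rightarrow> real list" where
  "eigvals A = sorted_list_of_multiset (proots (charpoly A))"

definition nondeg_index1_saddle :: "(real^'n \<Rightarrow> real) \<Rightarrow> real^'n \<Rightarrow> bool" where
  "nondeg_index1_saddle E z \<longleftrightarrow>
     grad E z = 0 \<and>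
     length (filter (\<lambda>l. l < 0) (eigvals (hess E z))) = 1 \<and>
     0 \<notin> set (eigvals (hess E z))"

definition outer :: "real^'n \<Rightarrow> real^'n \<Rightarrow> real^'n^'n" where
  "outer v w = (\<chi> i j. v $ i * w $ j)"

end

theory Submission
  imports Defs
begin

text \<open>
  Write \<open>e\<^sub>n = x\<^sub>n - x\<^sup>*\<close>, let \<open>H\<close> be the Hessian at \<open>x\<^sub>n\<close>, and let \<open>R = I - 2 v v\<^sup>T\<close> be the
  reflection used in the step. Since \<open>H\<close> is symmetric and \<open>v\<close> is its lowest eigenvector, \<open>R\<close>
  commutes with \<open>H\<close> and \<open>R H\<close> is \<open>H\<close> with its only negative eigenvalue \<open>\<lambda>\<^sub>1\<close> replaced by
  \<open>\<bar>\<lambda>\<^sub>1\<bar>\<close>. So \<open>R H\<close> is symmetric with spectrum in \<open>[\<mu>, L]\<close>, and the saddle search behaves like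
  gradient descent near a strict minimum: for \<open>\<beta> = 2 / (L + \<mu>)\<close> the eigenvalues of
  \<open>I - \<beta> R H\<close> lie between \<open>\<plusminus>(L - \<mu>) / (L + \<mu>)\<close> (lemma \<open>reflected_step_contracts\<close>). The gradient
  differs from its linearisation \<open>H e\<^sub>n\<close> by at most \<open>M \<parallel>e\<^sub>n\<parallel>\<^sup>2 / 2\<close>
  (\<open>taylor_remainder_bound\<close>), and \<open>R\<close> is an isometry, so
  \<open>r\<^sub>n\<^sub>+\<^sub>1 \<le> (L - \<mu>) / (L + \<mu>) r\<^sub>n + M / (L + \<mu>) r\<^sub>n\<^sup>2\<close>.

  With \<open>a\<^sub>n = r\<^sub>n M / (2 \<mu>)\<close> and \<open>q = 2 \<mu> / (L + \<mu>)\<close> this reads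
  \<open>a\<^sub>n\<^sub>+\<^sub>1 \<le> a\<^sub>n (1 - q (1 - a\<^sub>n))\<close>. The quantity \<open>a / (1 - a)\<close> then shrinks at every step at least by the
  factor \<open>1 / (1 + q) = 1 - 2 / (\<kappa> + 3)\<close> (\<open>quadratic_recursion_bound\<close>), which gives the claimed rate
  together with the constant.

  Two links between analysis and spectrum carry the argument. The Hessian is symmetric because second
  differences of \<open>E\<close> do not depend on the order of the two increments
  (\<open>second_derivative_symmetric\<close>). Eigenvalues are given as the list of roots of the characteristic
  polynomial; to know that eigenvectors orthogonal to \<open>v\<close> belong to the positive entries of that list,
  a second independent eigenvector for \<open>\<lambda>\<^sub>1\<close> must force a second entry \<open>\<lambda>\<^sub>1\<close>, which is the inequality
  between geometric and algebraic multiplicity (\<open>card_eigenvectors_le_count_eigvals\<close>).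
\<close>

section \<open>Multiplicity of eigenvalues\<close>

definition charmat :: "real^'n^'n \<Rightarrow> real poly^'n^'n" where
  "charmat A = (\<chi> i j. (if i = j then [:0, 1:] else 0) - [:A $ i $ j:])"

lemma charpoly_eq_det_charmat: "charpoly A = det (charmat A)"
  by (simp add: charpoly_def charmat_def)

lemma poly_det: "poly (det P) t = det (\<chi> i j. poly (P $ i $ j) t)"
  for P :: "'a::comm_ring_1 poly^'n^'n"
  by (simp add: det_def poly_sum poly_prod)

lemma det_const_poly: "det (\<chi> i j. [:C $ i $ j:]) = [:det C:]" for C :: "real^'n^'n"
  by (simp add: poly_eq_poly_eq_iff[symmetric] fun_eq_iff poly_det)

lemma poly_charpoly: "poly (charpoly A) t = det (mat t - A)"
proof -
  have "(\<chi> i j. poly (charmat A $ i $ j) t) = mat t - A"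
    by (simp add: charmat_def vec_eq_iff mat_def)
  then show ?thesis
    by (simp add: charpoly_eq_det_charmat poly_det)
qed

text \<open>
  If the polynomial vanished, every real number would be an eigenvalue, while eigenvalues are bounded
  by the operator norm.
\<close>
lemma charpoly_nonzero: "charpoly A \<noteq> 0"
proof
  assume "charpoly A = 0"
  define t where "t = onorm ((*v) A) + 1"
  have "det (mat t - A) = 0"
    using \<open>charpoly A = 0\<close> poly_charpoly[of A t] by simp
  then obtain x where "x \<noteq> 0" and "(mat t - A) *v x = 0"
    using invertible_det_nz[of "mat t - A"] matrix_left_invertible_ker[of "mat t - A"]
      invertible_left_inverse[of "mat t - A"] by auto
  moreover have "mat t *v x = t *\<^sub>R x"
    by (simp add: vec_eq_iff matrix_vector_mult_def mat_def if_distribR sum.delta if_distrib cong: if_cong)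
  ultimately have "A *v x = t *\<^sub>R x"
    by (simp add: matrix_vector_mult_diff_rdistrib)
  then have "\<bar>t\<bar> * norm x \<le> onorm ((*v) A) * norm x"
    using onorm[of "(*v) A" x] by (simp add: matrix_vector_mul_bounded_linear)
  moreover have "0 \<le> onorm ((*v) A)"
    by (simp add: onorm_pos_le matrix_vector_mul_bounded_linear)
  ultimately show False
    using \<open>x \<noteq> 0\<close> by (simp add: t_def mult_le_cancel_right)
qed

lemma degree_charpoly_le: "degree (charpoly A) \<le> CARD('n)" for A :: "real^'n^'n"
proof -
  have entry: "degree (charmat A $ i $ j) \<le> 1" for i j
    unfolding charmat_def by (auto intro!: degree_diff_le)
  have "degree (\<Prod>i\<in>UNIV. charmat A $ i $ p i) \<le> CARD('n)" for p
  proof -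
    have "degree (\<Prod>i\<in>UNIV. charmat A $ i $ p i) \<le> (\<Sum>i\<in>UNIV. degree (charmat A $ i $ p i))"
      using degree_prod_sum_le[of UNIV "\<lambda>i. charmat A $ i $ p i"] by (simp add: o_def)
    also have "\<dots> \<le> (\<Sum>i\<in>(UNIV::'n set). 1)"
      by (intro sum_mono entry)
    finally show ?thesis by simp
  qed
  moreover have "degree (of_int c * q) \<le> degree q" for c and q :: "real poly"
    by (simp add: of_int_poly degree_smult_le)
  ultimately show ?thesis
    unfolding charpoly_eq_det_charmat det_def
    by (intro degree_sum_le) (auto intro: order_trans)
qed

lemma length_eigvals_le: "length (eigvals A) \<le> CARD('n)" for A :: "real^'n^'n"
proof -
  have "length (eigvals A) = size (proots (charpoly A))"
    by (metis eigvals_def mset_sorted_list_of_multiset size_mset)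
  then show ?thesis
    using size_proots_le[of "charpoly A"] degree_charpoly_le[of A] by linarith
qed

text \<open>
  Multiplying \<open>X I - A\<close> on the right by \<open>C\<close> turns each column \<open>c\<close> of \<open>C\<close> that is an eigenvector into
  \<open>(X - l) c\<close>. One linear factor can thus be pulled out of the determinant for each such column,
  and \<open>det C\<close> is a nonzero constant.
\<close>
lemma eigencolumns_power_dvd_charpoly:
  fixes A C :: "real^'n^'n"
  assumes "det C \<noteq> 0"
    and eig: "\<And>j. j \<in> S \<Longrightarrow> A *v column j C = l *\<^sub>R column j C"
  shows "[:-l, 1:] ^ card S dvd charpoly A"
proof -
  define K :: "real poly^'n^'n" where "K = (\<chi> i j. [:C $ i $ j:])"
  \<comment> \<open>\<open>N\<close> is \<open>(X I - A) C\<close> with the factors \<open>X - l\<close> removed from the columns in \<open>S\<close>;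
      the diagonal matrix \<open>D\<close> holds the removed factors.\<close>
  define D :: "real poly^'n^'n" where
    "D = (\<chi> i j. if i = j then (if j \<in> S then [:-l, 1:] else 1) else 0)"
  define N :: "real poly^'n^'n" where
    "N = (\<chi> i j. if j \<in> S then K $ i $ j else (charmat A ** K) $ i $ j)"
  have AK: "(charmat A ** K) $ i $ j = [:0, 1:] * K $ i $ j - [:(A ** C) $ i $ j:]" for i j
  proof -
    have "(charmat A ** K) $ i $ j
        = (\<Sum>k\<in>UNIV. (if i = k then [:0, 1:] * K $ k $ j else 0) - [:A $ i $ k * C $ k $ j:])"
      unfolding matrix_matrix_mult_def charmat_def K_def
      by (auto simp: algebra_simps intro!: sum.cong)
    also have "\<dots> = [:0, 1:] * K $ i $ j - (\<Sum>k\<in>UNIV. [:A $ i $ k * C $ k $ j:])"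
      by (simp add: sum_subtractf)
    also have "(\<Sum>k\<in>UNIV. [:A $ i $ k * C $ k $ j:]) = [:(A ** C) $ i $ j:]"
      by (simp add: matrix_matrix_mult_def poly_eq_poly_eq_iff[symmetric] fun_eq_iff poly_sum)
    finally show ?thesis .
  qed
  have AC: "(A ** C) $ i $ j = l * C $ i $ j" if "j \<in> S" for i j
    using arg_cong[OF eig[OF that], of "\<lambda>w. w $ i"]
    by (simp add: matrix_matrix_mult_def matrix_vector_mult_def column_def)
  have "charmat A ** K = N ** D"
  proof -
    have "(N ** D) $ i $ j = N $ i $ j * (if j \<in> S then [:-l, 1:] else 1)" for i j
    proof -
      have "(N ** D) $ i $ j
          = (\<Sum>k\<in>UNIV. if k = j then N $ i $ j * (if j \<in> S then [:-l, 1:] else 1) else 0)"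
        unfolding matrix_matrix_mult_def D_def vec_lambda_beta by (rule sum.cong) auto
      then show ?thesis by simp
    qed
    moreover have "(charmat A ** K) $ i $ j = N $ i $ j * (if j \<in> S then [:-l, 1:] else 1)" for i j
      by (cases "j \<in> S") (simp_all only: N_def AK AC if_True if_False vec_lambda_beta, simp_all add: K_def)
    ultimately show ?thesis
      by (simp add: vec_eq_iff)
  qed
  then have "det (charmat A) * det K = det N * det D"
    by (metis det_mul)
  moreover have "det D = [:-l, 1:] ^ card S"
  proof -
    have "det D = (\<Prod>j\<in>UNIV. if j \<in> S then [:-l, 1:] else 1)"
      by (subst det_diagonal) (auto simp: D_def)
    also have "\<dots> = (\<Prod>j\<in>S. [:-l, 1:])"
      by (simp add: prod.If_cases)
    finally show ?thesis by simp
  qed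
  moreover have "det K = [:det C:]"
    by (simp add: K_def det_const_poly)
  ultimately have "smult (det C) (charpoly A) = det N * [:-l, 1:] ^ card S"
    by (simp add: charpoly_eq_det_charmat)
  then have "[:-l, 1:] ^ card S dvd smult (det C) (charpoly A)"
    by simp
  with \<open>det C \<noteq> 0\<close> show ?thesis
    by (rule dvd_smult_cancel[rotated])
qed

text \<open>
  The geometric multiplicity of an eigenvalue is at most its algebraic multiplicity: extend the
  eigenvectors to a basis and take this basis as the columns of the invertible matrix in the previous
  lemma.
\<close>
lemma card_eigenvectors_le_count_eigvals:
  fixes A :: "real^'n^'n"
  assumes "independent V"
    and eig: "\<And>v. v \<in> V \<Longrightarrow> A *v v = l *\<^sub>R v"
  shows "card V \<le> count (mset (eigvals A)) l"
proof -
  obtain B where B: "V \<subseteq> B" "independent B" "span B = (UNIV :: (real^'n) set)"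
    using maximal_independent_subset_extend[OF subset_UNIV assms(1)] by (metis top_le)
  have "finite B"
    using B(2) by (rule independent_imp_finite)
  have cardB: "card B = CARD('n)"
    using dim_eq_card[of B UNIV] B by (simp add: dim_UNIV)
  then obtain f :: "'n \<Rightarrow> real^'n" where f: "bij_betw f UNIV B"
    using finite_same_card_bij[of "UNIV :: 'n set" B] \<open>finite B\<close> by auto
  define C where "C = (\<chi> i j. f j $ i)"
  have col: "column j C = f j" for j
    by (simp add: C_def column_def vec_eq_iff)
  have "columns C = B"
    using f by (auto simp: columns_def col bij_betw_def)
  then have "rank C = CARD('n)"
    using dim_eq_card_independent[OF B(2)] cardB by (simp add: column_rank_def)
  then have "det C \<noteq> 0"
    by (simp add: det_eq_0_rank)
  then have "[:-l, 1:] ^ card (f -` V) dvd charpoly A"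
    by (rule eigencolumns_power_dvd_charpoly) (simp add: col eig)
  moreover have "card (f -` V) = card V"
    using f B(1) by (intro card_vimage_inj) (auto simp: bij_betw_def)
  ultimately show ?thesis
    using charpoly_nonzero[of A] by (simp add: eigvals_def order_divides)
qed

section \<open>Norms of symmetric operators\<close>

text \<open>
  This is the only piece of the spectral theorem that the convergence proof needs: to bound the norm of
  a symmetric operator it suffices to bound its eigenvalues. Let \<open>s\<close> be the norm of \<open>T\<close>, attained
  at a unit vector \<open>w\<close>. Equality in Cauchy--Schwarz gives \<open>T\<^sup>2 w = s\<^sup>2 w\<close>, that is
  \<open>(T - s) (T + s) w = 0\<close>; so either \<open>w\<close> is an eigenvector for \<open>-s\<close>, or \<open>(T + s) w\<close> is one
  for \<open>s\<close>.
\<close>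
lemma symmetric_operator_norm_is_eigenvalue:
  fixes T :: "'a::euclidean_space \<Rightarrow> 'a"
  assumes "linear T" and sym: "\<And>x y. T x \<bullet> y = x \<bullet> T y"
  obtains u t where "u \<noteq> 0" "T u = t *\<^sub>R u" "\<And>x. norm (T x) \<le> \<bar>t\<bar> * norm x"
proof -
  have "compact (sphere (0::'a) 1)" "sphere (0::'a) 1 \<noteq> {}"
    by (simp_all add: sphere_eq_empty)
  moreover have "continuous_on (sphere 0 1) (\<lambda>x. norm (T x))"
    using \<open>linear T\<close> by (intro continuous_on_norm linear_continuous_on linear_conv_bounded_linear[THEN iffD1])
  ultimately obtain w where "w \<in> sphere 0 1"
    and max: "\<And>x. x \<in> sphere 0 1 \<Longrightarrow> norm (T x) \<le> norm (T w)"
    by (metis continuous_attains_sup)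
  then have w: "norm w = 1" by simp
  define s where "s = norm (T w)"
  have bound: "norm (T x) \<le> s * norm x" for x
  proof (cases "x = 0")
    case False
    then show ?thesis
      using max[of "sgn x"] linear_scale[OF \<open>linear T\<close>, of "inverse (norm x)" x]
      by (simp add: s_def sgn_div_norm norm_sgn field_simps)
  qed (simp add: linear_0[OF \<open>linear T\<close>])
  have TT: "T (T w) = s\<^sup>2 *\<^sub>R w"
  proof -
    have "T (T w) \<bullet> w = s\<^sup>2"
      by (metis sym s_def power2_norm_eq_inner)
    moreover have "T (T w) \<bullet> T (T w) \<le> (s * s)\<^sup>2"
      using bound[of "T w"] by (simp add: s_def power2_norm_eq_inner[symmetric] power_mono)
    ultimately have "(T (T w) - s\<^sup>2 *\<^sub>R w) \<bullet> (T (T w) - s\<^sup>2 *\<^sub>R w) \<le> 0"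
      using w by (simp add: inner_diff inner_commute norm_eq_1 power2_eq_square algebra_simps)
    then have "T (T w) - s\<^sup>2 *\<^sub>R w = 0"
      by (metis inner_eq_zero_iff inner_ge_zero order_antisym)
    then show ?thesis by simp
  qed
  show thesis
  proof (cases "T w + s *\<^sub>R w = 0")
    case True
    have "w \<noteq> 0" using w by auto
    moreover have "T w = (- s) *\<^sub>R w" using True by (simp add: eq_neg_iff_add_eq_0)
    ultimately show ?thesis
      using that[of w "- s"] bound by (simp add: s_def)
  next
    case False
    have "T (T w + s *\<^sub>R w) = s *\<^sub>R (T w + s *\<^sub>R w)"
      by (simp add: linear_add[OF \<open>linear T\<close>] linear_scale[OF \<open>linear T\<close>] TT
          power2_eq_square algebra_simps)
    then show ?thesis
      using that[of "T w + s *\<^sub>R w" s] False bound by (simp add: s_def)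
  qed
qed

section \<open>Gradient and Hessian\<close>

text \<open>
  The Riesz representative of the derivative exists and is unique, so the definite description in
  \<^const>\<open>grad\<close> denotes it.
\<close>
lemma differentiable_imp_GDERIV_grad:
  fixes E :: "'a::euclidean_space \<Rightarrow> real"
  assumes "E differentiable (at y)"
  shows "GDERIV E y :> grad E y"
proof -
  obtain f' where f': "(E has_derivative f') (at y)"
    using assms by (auto simp: differentiable_def)
  interpret f': bounded_linear f' using f' by (rule has_derivative_bounded_linear)
  have "f' h = h \<bullet> (\<Sum>b\<in>Basis. f' b *\<^sub>R b)" for h
  proof -
    have "f' h = f' (\<Sum>b\<in>Basis. (h \<bullet> b) *\<^sub>R b)" by (simp add: euclidean_representation)
    then show ?thesis by (simp add: f'.sum f'.scaleR inner_sum_right mult.commute)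
  qed
  then have "f' = (\<lambda>h. h \<bullet> (\<Sum>b\<in>Basis. f' b *\<^sub>R b))" by blast
  then have ex: "GDERIV E y :> (\<Sum>b\<in>Basis. f' b *\<^sub>R b)"
    using f' by (simp add: gderiv_def)
  moreover have "D = D'" if "GDERIV E y :> D" "GDERIV E y :> D'" for D D'
  proof -
    have "(\<lambda>h. h \<bullet> D) = (\<lambda>h. h \<bullet> D')"
      using that unfolding gderiv_def by (rule has_derivative_unique)
    then show ?thesis by (metis vector_eq_ldot)
  qed
  ultimately show ?thesis
    unfolding grad_def by (metis theI)
qed

text \<open>
  By the mean value theorem along \<open>h\<close>, the second difference equals \<open>t h \<bullet> (F (p + t k) - F p)\<close> at
  an intermediate point \<open>p\<close>, and differentiability of \<open>F\<close> at the single point \<open>x\<close> turns the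
  bracket into \<open>t A k + o(t)\<close>.
\<close>
lemma second_difference_bound:
  fixes E :: "'a::real_inner \<Rightarrow> real"
  assumes grad: "\<And>y. GDERIV E y :> F y" and "(F has_derivative A) (at x)" and "e > 0"
  obtains d where "d > 0"
    "\<And>t. 0 < t \<Longrightarrow> t < d \<Longrightarrow>
       \<bar>E (x + t *\<^sub>R h + t *\<^sub>R k) - E (x + t *\<^sub>R h) - E (x + t *\<^sub>R k) + E x - t\<^sup>2 * (A k \<bullet> h)\<bar> \<le> e * t\<^sup>2"
proof -
  interpret A: bounded_linear A
    using assms(2) by (rule has_derivative_bounded_linear)
  \<comment> \<open>The relative linearisation error \<open>c\<close> of \<open>F\<close> is incurred at two points, at distances at most
      \<open>t (\<parallel>h\<parallel> + \<parallel>k\<parallel>)\<close> and \<open>t \<parallel>h\<parallel>\<close>; the summand 1 covers \<open>h = 0\<close>.\<close>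
  define c where "c = e / (norm h * (2 * norm h + norm k) + 1)"
  have pos: "0 < norm h * (2 * norm h + norm k) + 1"
    by (simp add: add_nonneg_pos)
  have "c > 0" using \<open>e > 0\<close> pos by (simp add: c_def)
  then obtain d where "d > 0"
    and d: "\<And>y. norm (y - x) < d \<Longrightarrow> norm (F y - F x - A (y - x)) \<le> c * norm (y - x)"
    using assms(2) unfolding has_derivative_at_alt by blast
  have pos': "0 < norm h + norm k + 1" by (simp add: add_nonneg_pos)
  show thesis
  proof (rule that[of "d / (norm h + norm k + 1)"])
    show "0 < d / (norm h + norm k + 1)" using \<open>d > 0\<close> pos' by simp
  next
    fix t assume t: "0 < t" "t < d / (norm h + norm k + 1)"
    define g where "g s = E (x + s *\<^sub>R h + t *\<^sub>R k) - E (x + s *\<^sub>R h)" for s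
    have E: "(E has_derivative (\<lambda>z. z \<bullet> F y)) (at y within S)" for y S
      using grad[of y] by (simp add: gderiv_def has_derivative_at_withinI)
    have "(g has_derivative
        (\<lambda>r. r * (h \<bullet> (F (x + s *\<^sub>R h + t *\<^sub>R k) - F (x + s *\<^sub>R h))))) (at s within {0..t})" for s
      unfolding g_def
      by (rule derivative_eq_intros has_derivative_compose[OF _ E] refl
          | simp add: inner_diff_right algebra_simps)+
    then obtain s where s: "s \<in> {0<..<t}"
      and gs: "g t - g 0 = (t - 0) * (h \<bullet> (F (x + s *\<^sub>R h + t *\<^sub>R k) - F (x + s *\<^sub>R h)))"
      using mvt_simple[of 0 t g "\<lambda>s r. r * (h \<bullet> (F (x + s *\<^sub>R h + t *\<^sub>R k) - F (x + s *\<^sub>R h)))"] t(1)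
      by blast
    have small: "norm (s *\<^sub>R h) \<le> t * norm h" "norm (s *\<^sub>R h + t *\<^sub>R k) \<le> t * (norm h + norm k)"
    proof -
      show 1: "norm (s *\<^sub>R h) \<le> t * norm h"
        using s by (simp add: mult_right_mono)
      show "norm (s *\<^sub>R h + t *\<^sub>R k) \<le> t * (norm h + norm k)"
        using norm_triangle_ineq[of "s *\<^sub>R h" "t *\<^sub>R k"] 1 t(1) by (simp add: distrib_left)
    qed
    have td: "t * (norm h + norm k) < d" "t * norm h < d"
    proof -
      have "t * (norm h + norm k + 1) < d" using t pos' by (simp add: field_simps)
      moreover have "0 \<le> t * norm k" using t(1) by simp
      ultimately show "t * (norm h + norm k) < d" "t * norm h < d"
        using t(1) unfolding distrib_left by linarith+
    qed
    define r1 where "r1 = F (x + s *\<^sub>R h + t *\<^sub>R k) - F x - A (s *\<^sub>R h + t *\<^sub>R k)"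
    define r2 where "r2 = F (x + s *\<^sub>R h) - F x - A (s *\<^sub>R h)"
    have "norm r1 \<le> c * (t * (norm h + norm k))"
    proof -
      have "norm r1 \<le> c * norm (s *\<^sub>R h + t *\<^sub>R k)"
        using d[of "x + s *\<^sub>R h + t *\<^sub>R k"] small td by (simp add: r1_def add.assoc)
      then show ?thesis
        using small(2) \<open>c > 0\<close> by (meson mult_left_mono less_imp_le order_trans)
    qed
    moreover have "norm r2 \<le> c * (t * norm h)"
    proof -
      have "norm r2 \<le> c * norm (s *\<^sub>R h)"
        using d[of "x + s *\<^sub>R h"] small td by (simp add: r2_def)
      then show ?thesis
        using small(1) \<open>c > 0\<close> by (meson mult_left_mono less_imp_le order_trans)
    qed
    ultimately have "norm (r1 - r2) \<le> c * t * (2 * norm h + norm k)"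
      using norm_triangle_ineq4[of r1 r2] by (simp add: algebra_simps)
    then have "norm h * norm (r1 - r2) \<le> norm h * (c * t * (2 * norm h + norm k))"
      by (intro mult_left_mono) auto
    then have "\<bar>h \<bullet> (r1 - r2)\<bar> \<le> norm h * (c * t * (2 * norm h + norm k))"
      using Cauchy_Schwarz_ineq2[of h "r1 - r2"] by linarith
    also have "\<dots> \<le> t * (c * (norm h * (2 * norm h + norm k) + 1))"
      using t(1) \<open>c > 0\<close> by (simp add: algebra_simps)
    also have "\<dots> = t * e"
      using pos by (simp add: c_def)
    finally have "t * \<bar>h \<bullet> (r1 - r2)\<bar> \<le> t * (t * e)"
      using t(1) by (intro mult_left_mono) auto
    moreover have "F (x + s *\<^sub>R h + t *\<^sub>R k) - F (x + s *\<^sub>R h) = t *\<^sub>R A k + (r1 - r2)"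
      by (simp add: r1_def r2_def A.add A.scaleR)
    then have "g t - g 0 = t\<^sup>2 * (A k \<bullet> h) + t * (h \<bullet> (r1 - r2))"
      using gs by (simp add: inner_add_right inner_commute power2_eq_square distrib_left)
    then have "E (x + t *\<^sub>R h + t *\<^sub>R k) - E (x + t *\<^sub>R h) - E (x + t *\<^sub>R k) + E x - t\<^sup>2 * (A k \<bullet> h)
        = t * (h \<bullet> (r1 - r2))"
      by (simp add: g_def)
    ultimately show "\<bar>E (x + t *\<^sub>R h + t *\<^sub>R k) - E (x + t *\<^sub>R h) - E (x + t *\<^sub>R k) + E x - t\<^sup>2 * (A k \<bullet> h)\<bar> \<le> e * t\<^sup>2"
      using t(1) by (simp add: abs_mult power2_eq_square mult_ac)
  qed
qed

text \<open>
  The second difference is symmetric in \<open>h\<close> and \<open>k\<close>, so its two asymptotic expansions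
  \<open>t\<^sup>2 (A k \<bullet> h)\<close> and \<open>t\<^sup>2 (A h \<bullet> k)\<close> agree.
\<close>
lemma second_derivative_symmetric:
  fixes E :: "'a::real_inner \<Rightarrow> real"
  assumes "\<And>y. GDERIV E y :> F y" and "(F has_derivative A) (at x)"
  shows "A h \<bullet> k = h \<bullet> A k"
proof -
  have "\<bar>A k \<bullet> h - A h \<bullet> k\<bar> \<le> e" if "e > 0" for e
  proof -
    have "e / 2 > 0" using that by simp
    obtain d1 where d1: "d1 > 0" "\<And>t. 0 < t \<Longrightarrow> t < d1 \<Longrightarrow>
       \<bar>E (x + t *\<^sub>R h + t *\<^sub>R k) - E (x + t *\<^sub>R h) - E (x + t *\<^sub>R k) + E x - t\<^sup>2 * (A k \<bullet> h)\<bar> \<le> e / 2 * t\<^sup>2"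
      using second_difference_bound[OF assms \<open>e / 2 > 0\<close>, where h = h and k = k] by blast
    obtain d2 where d2: "d2 > 0" "\<And>t. 0 < t \<Longrightarrow> t < d2 \<Longrightarrow>
       \<bar>E (x + t *\<^sub>R k + t *\<^sub>R h) - E (x + t *\<^sub>R k) - E (x + t *\<^sub>R h) + E x - t\<^sup>2 * (A h \<bullet> k)\<bar> \<le> e / 2 * t\<^sup>2"
      using second_difference_bound[OF assms \<open>e / 2 > 0\<close>, where h = k and k = h] by blast
    define t where "t = min d1 d2 / 2"
    have t: "0 < t" "t < d1" "t < d2" using d1(1) d2(1) by (auto simp: t_def min_def)
    have swap: "x + t *\<^sub>R k + t *\<^sub>R h = x + t *\<^sub>R h + t *\<^sub>R k" by simp
    have "\<bar>t\<^sup>2 * (A k \<bullet> h) - t\<^sup>2 * (A h \<bullet> k)\<bar> \<le> e * t\<^sup>2"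
      using d1(2)[OF t(1,2)] d2(2)[OF t(1,3)] unfolding swap by linarith
    then have "\<bar>t\<^sup>2 * (A k \<bullet> h - A h \<bullet> k)\<bar> \<le> t\<^sup>2 * e"
      by (simp add: right_diff_distrib mult.commute)
    then have "t\<^sup>2 * \<bar>A k \<bullet> h - A h \<bullet> k\<bar> \<le> t\<^sup>2 * e"
      by (simp only: abs_mult abs_power2)
    then show ?thesis using t(1) by simp
  qed
  then have "\<bar>A k \<bullet> h - A h \<bullet> k\<bar> \<le> 0"
    by (rule field_le_epsilon[where y = 0, simplified])
  then show ?thesis by (simp add: inner_commute)
qed

text \<open>
  On the segment from \<open>y\<close> to \<open>z\<close>, with \<open>d = z - y\<close>, the function
  \<open>s \<mapsto> F (y + s d) - s H\<^sub>y d\<close> has speed at most \<open>M s \<parallel>d\<parallel>\<^sup>2\<close>. Comparing it with the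
  primitive \<open>M s\<^sup>2 \<parallel>d\<parallel>\<^sup>2 / 2\<close> of that bound, rather than with a constant, yields the factor one half
  on which the radius \<open>2 \<mu> / M\<close> depends.
\<close>
lemma taylor_remainder_bound:
  fixes F :: "'a::real_normed_vector \<Rightarrow> 'b::real_normed_vector"
  assumes "convex S" "y \<in> S" "z \<in> S"
    and der: "\<And>w. w \<in> S \<Longrightarrow> (F has_derivative H w) (at w)"
    and lip: "\<And>w h. w \<in> S \<Longrightarrow> norm (H w h - H y h) \<le> M * norm (w - y) * norm h"
  shows "norm (F z - F y - H y (z - y)) \<le> M / 2 * (norm (z - y))\<^sup>2"
proof -
  define d where "d = z - y"
  define f where "f s = F (y + s *\<^sub>R d) - s *\<^sub>R H y d" for s :: real
  define \<phi> where "\<phi> s = M / 2 * (norm d)\<^sup>2 * s\<^sup>2" for s :: real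
  have seg: "y + s *\<^sub>R d \<in> S" if "0 \<le> s" "s \<le> 1" for s
    using convexD_alt[OF assms(1-3) that] by (simp add: d_def algebra_simps)
  have f': "(f has_vector_derivative (H (y + s *\<^sub>R d) d - H y d)) (at s)" if "0 \<le> s" "s \<le> 1" for s
  proof -
    have lin: "bounded_linear (H (y + s *\<^sub>R d))"
      using der[OF seg[OF that]] by (rule has_derivative_bounded_linear)
    have "((\<lambda>r. F (y + r *\<^sub>R d)) has_derivative (\<lambda>r. H (y + s *\<^sub>R d) (r *\<^sub>R d))) (at s)"
      by (rule has_derivative_compose[where f = "\<lambda>r. y + r *\<^sub>R d", OF _ der[OF seg[OF that]]])
        (auto intro!: derivative_eq_intros)
    then have "((\<lambda>r. F (y + r *\<^sub>R d)) has_vector_derivative H (y + s *\<^sub>R d) d) (at s)"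
      by (simp add: has_vector_derivative_def linear_cmul[OF bounded_linear.linear[OF lin]])
    then show ?thesis
      unfolding f_def by (auto intro!: derivative_eq_intros)
  qed
  have \<phi>': "(\<phi> has_vector_derivative (M * (norm d)\<^sup>2 * s)) (at s)" for s
    unfolding \<phi>_def has_real_derivative_iff_has_vector_derivative[symmetric]
    by (auto intro!: derivative_eq_intros)
  have "norm (f 1 - f 0) \<le> \<phi> 1 - \<phi> 0"
  proof (rule differentiable_bound_general[OF zero_less_one _ _ f' \<phi>'])
    show "continuous_on {0..1} f"
      by (rule continuous_at_imp_continuous_on) (auto intro: has_vector_derivative_continuous[OF f'])
    show "continuous_on {0..1} \<phi>"
      by (simp add: \<phi>_def continuous_intros)
    show "norm (H (y + s *\<^sub>R d) d - H y d) \<le> M * (norm d)\<^sup>2 * s" if "0 < s" "s < 1" for s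
      using lip[OF seg, of s d] that by (simp add: power2_eq_square mult_ac)
  qed auto
  then show ?thesis
    by (simp add: f_def \<phi>_def d_def algebra_simps)
qed

section \<open>The reflected gradient step\<close>

definition reflect :: "'a::real_inner \<Rightarrow> 'a \<Rightarrow> 'a" where
  "reflect v w = w - (2 * (v \<bullet> w)) *\<^sub>R v"

lemma mat_minus_outer_mult: "(mat 1 - 2 *\<^sub>R outer v v) *v w = reflect v w"
proof -
  have "(outer v v *v w) $ i = (v \<bullet> w) * v $ i" for i
    by (simp add: outer_def matrix_vector_mult_def inner_vec_def sum_distrib_left mult_ac)
  then have "outer v v *v w = (v \<bullet> w) *\<^sub>R v"
    by (simp add: vec_eq_iff)
  then show ?thesis
    by (simp add: reflect_def matrix_vector_mult_diff_rdistrib scaleR_matrix_vector_assoc[symmetric])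
qed

lemma norm_reflect: "norm v = 1 \<Longrightarrow> norm (reflect v w) = norm w"
  by (simp add: norm_eq reflect_def inner_diff inner_commute norm_eq_1 algebra_simps)

lemma linear_reflect: "linear (reflect v)"
  by (rule linearI) (simp_all add: reflect_def inner_add_right algebra_simps)

text \<open>
  An eigenvector orthogonal to \<open>v\<close> cannot belong to the lowest eigenvalue: together with \<open>v\<close> it would
  make that eigenvalue occur twice in the list, and the second occurrence would be a negative entry at a
  positive index.
\<close>
lemma eigenvalue_orthogonal_to_lowest:
  fixes A :: "real^'n^'n"
  assumes v: "norm v = 1" "A *v v = (eigvals A ! 0) *\<^sub>R v"
    and lowest: "eigvals A ! 0 < 0"
    and pos: "\<And>i. 1 \<le> i \<Longrightarrow> i < CARD('n) \<Longrightarrow> 0 < eigvals A ! i"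
    and u: "u \<noteq> 0" "v \<bullet> u = 0" "A *v u = p *\<^sub>R u"
  obtains i where "1 \<le> i" "i < CARD('n)" "p = eigvals A ! i"
proof -
  let ?xs = "eigvals A"
  have count: "count (mset ?xs) l = card {i. i < length ?xs \<and> ?xs ! i = l}" for l
    using count_mset[of ?xs l] by (simp add: length_filter_conv_card eq_commute count_list_eq_length_filter)
  have "independent {u}" using u(1) by simp
  then have "1 \<le> card {i. i < length ?xs \<and> ?xs ! i = p}"
    using card_eigenvectors_le_count_eigvals[of "{u}" A p] u(3) by (simp add: count)
  then have "{i. i < length ?xs \<and> ?xs ! i = p} \<noteq> {}"
    by (intro notI) simp
  then obtain i where i: "i < length ?xs" "?xs ! i = p"
    by blast
  show thesis
  proof (cases "i = 0")
    case False
    then show ?thesis using that[of i] i length_eigvals_le[of A] by simp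
  next
    case True
    then have p: "p = ?xs ! 0" using i by simp
    have "v \<noteq> u" "v \<noteq> 0" using v(1) u(1,2) by auto
    have "independent {v, u}"
    proof (rule pairwise_orthogonal_independent)
      show "pairwise orthogonal {v, u}"
        using u(2) by (auto simp: pairwise_def orthogonal_def inner_commute)
      show "0 \<notin> {v, u}" using \<open>v \<noteq> 0\<close> u(1) by auto
    qed
    then have "card {v, u} \<le> card {i. i < length ?xs \<and> ?xs ! i = p}"
      unfolding count[symmetric] using v u p
      by (intro card_eigenvectors_le_count_eigvals) auto
    moreover have "card {i. i < length ?xs \<and> ?xs ! i = p} \<le> card {0::nat}"
    proof (rule card_mono)
      have "\<not> 1 \<le> j" if "j < length ?xs" "?xs ! j = p" for j
        using pos[of j] that length_eigvals_le[of A] lowest p by auto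
      then show "{i. i < length ?xs \<and> ?xs ! i = p} \<subseteq> {0}" by force
    qed simp
    ultimately show ?thesis using \<open>v \<noteq> u\<close> by simp
  qed
qed

text \<open>
  Write \<open>R\<close> for the reflection and \<open>\<beta> = 2 / (L + \<mu>)\<close>. The map \<open>T = I - \<beta> R A\<close> is symmetric because \<open>v\<close> is an eigenvector of \<open>A\<close>, so its norm is
  \<open>\<bar>t\<bar>\<close> for some eigenvalue \<open>t\<close> of \<open>T\<close>. The corresponding eigenvalue \<open>p\<close> of \<open>R A\<close> lies in
  \<open>[\<mu>, L]\<close>: an eigenvector that is not orthogonal to \<open>v\<close> has \<open>p = -\<lambda>\<^sub>1\<close>, and one orthogonal to \<open>v\<close> is
  an eigenvector of \<open>A\<close> itself for one of the positive eigenvalues. The step length \<open>2 / (L + \<mu>)\<close>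
  maps the two ends of \<open>[\<mu>, L]\<close> to opposite values of \<open>t\<close>.
\<close>
lemma reflected_step_contracts:
  fixes A :: "real^'n^'n"
  assumes sym: "\<And>x y. (A *v x) \<bullet> y = x \<bullet> (A *v y)"
    and v: "norm v = 1" "A *v v = (eigvals A ! 0) *\<^sub>R v"
    and lowest: "eigvals A ! 0 < 0"
    and pos: "\<And>i. 1 \<le> i \<Longrightarrow> i < CARD('n) \<Longrightarrow> 0 < eigvals A ! i"
    and range: "\<And>i. i < CARD('n) \<Longrightarrow> \<bar>eigvals A ! i\<bar> \<in> {\<mu>..L}"
    and "0 < \<mu>" "\<mu> < L"
  shows "norm (e - (2 / (L + \<mu>)) *\<^sub>R reflect v (A *v e)) \<le> (L - \<mu>) / (L + \<mu>) * norm e"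
proof -
  define l where "l = eigvals A ! 0"
  define T where "T x = x - (2 / (L + \<mu>)) *\<^sub>R reflect v (A *v x)" for x
  have vA: "v \<bullet> (A *v x) = l * (v \<bullet> x)" for x
    using sym[of v x] v(2) by (simp add: l_def)
  have lin: "linear T"
    unfolding T_def by (intro linear_compose_sub linear_ident linear_compose_scale_right
      linear_compose[OF matrix_vector_mul_linear linear_reflect, unfolded o_def])
  have symT: "T x \<bullet> y = x \<bullet> T y" for x y
    using sym[of x y]
    by (simp add: T_def reflect_def inner_diff_left inner_diff_right vA inner_commute algebra_simps)
  obtain u t where u: "u \<noteq> 0" "T u = t *\<^sub>R u"
    and norm: "\<And>x. norm (T x) \<le> \<bar>t\<bar> * norm x"
    using symmetric_operator_norm_is_eigenvalue[OF lin symT] by blast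
  \<comment> \<open>the eigenvalue of the reflected matrix that corresponds to the eigenvalue \<open>t\<close> of \<open>T\<close>\<close>
  define p where "p = (1 - t) * (L + \<mu>) / 2"
  have pt: "t = 1 - 2 / (L + \<mu>) * p"
    using \<open>0 < \<mu>\<close> \<open>\<mu> < L\<close> by (simp add: p_def diff_divide_distrib)
  have "(2 / (L + \<mu>)) *\<^sub>R reflect v (A *v u) = (2 / (L + \<mu>)) *\<^sub>R (p *\<^sub>R u)"
    using u(2) by (simp add: T_def pt scaleR_left_diff_distrib)
  then have P: "reflect v (A *v u) = p *\<^sub>R u"
    using \<open>0 < \<mu>\<close> \<open>\<mu> < L\<close> by (subst (asm) scaleR_cancel_left) auto
  have "\<mu> \<le> p \<and> p \<le> L"
  proof (cases "v \<bullet> u = 0")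
    case True
    then have "A *v u = p *\<^sub>R u"
      using P by (simp add: reflect_def vA)
    then obtain i where "1 \<le> i" "i < CARD('n)" "p = eigvals A ! i"
      using eigenvalue_orthogonal_to_lowest[OF v lowest pos u(1) True] by blast
    then show ?thesis using pos[of i] range[of i] by simp
  next
    case False
    have "p * (v \<bullet> u) = - l * (v \<bullet> u)"
      using arg_cong[OF P, of "inner v"] v(1) by (simp add: reflect_def inner_diff_right vA norm_eq_1)
    then have "p = - l" using False by (metis mult_right_cancel)
    then show ?thesis using range[of 0] lowest by (simp add: l_def)
  qed
  then have "\<bar>L + \<mu> - 2 * p\<bar> \<le> L - \<mu>" by linarith
  moreover have "t = (L + \<mu> - 2 * p) / (L + \<mu>)"
    using \<open>0 < \<mu>\<close> \<open>\<mu> < L\<close> by (simp add: pt diff_divide_distrib)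
  ultimately have "\<bar>t\<bar> \<le> (L - \<mu>) / (L + \<mu>)"
    using \<open>0 < \<mu>\<close> \<open>\<mu> < L\<close> by (simp add: divide_right_mono)
  then have "norm (T e) \<le> (L - \<mu>) / (L + \<mu>) * norm e"
    using norm[of e] by (meson mult_right_mono norm_ge_zero order_trans)
  then show ?thesis by (simp add: T_def)
qed

section \<open>Convergence of the saddle search\<close>

text \<open>
  The substitution \<open>b = a / (1 - a)\<close> linearises the recursion. If \<open>c = a (1 - q (1 - a))\<close>, then
  \<open>1 - c = (1 - a) (1 + q a)\<close>, so \<open>c / (1 - c)\<close> is \<open>b\<close> times
  \<open>(1 - q (1 - a)) / (1 + q a) \<le> 1 / (1 + q)\<close>. The recursion is assumed only while
  \<open>a n \<le> a 0\<close>, since for the iteration it holds only inside the ball around the saddle; the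
  induction therefore also carries \<open>a n \<le> a 0\<close>.
\<close>
lemma quadratic_recursion_bound:
  fixes a :: "nat \<Rightarrow> real"
  assumes "0 < q" "q < 1" and nonneg: "\<And>n. 0 \<le> a n" and "a 0 < 1"
    and step: "\<And>n. a n \<le> a 0 \<Longrightarrow> a (Suc n) \<le> a n * (1 - q * (1 - a n))"
  shows "a n \<le> (1 / (1 + q)) ^ n * (a 0 / (1 - a 0))"
proof -
  have "a n \<le> a 0 \<and> a n / (1 - a n) \<le> (1 / (1 + q)) ^ n * (a 0 / (1 - a 0))"
  proof (induction n)
    case (Suc n)
    define c where "c = a n * (1 - q * (1 - a n))"
    have an: "0 \<le> a n" "a n < 1" using nonneg[of n] Suc \<open>a 0 < 1\<close> by auto
    have "a (Suc n) \<le> c" using step Suc by (simp add: c_def)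
    have "c \<le> a n"
      unfolding c_def using an \<open>0 < q\<close> by (simp add: mult_left_le)
    have "c = a n - q * a n * (1 - a n)" by (simp add: c_def algebra_simps)
    have "a (Suc n) / (1 - a (Suc n)) \<le> c / (1 - c)"
      using \<open>a (Suc n) \<le> c\<close> \<open>c \<le> a n\<close> an nonneg[of "Suc n"] by (intro frac_le) auto
    also have "c / (1 - c) = a n / (1 - a n) * ((1 - q * (1 - a n)) / (1 + q * a n))"
    proof -
      have "1 - c = (1 - a n) * (1 + q * a n)" by (simp add: c_def algebra_simps)
      then show ?thesis by (simp add: c_def)
    qed
    also have "\<dots> \<le> a n / (1 - a n) * (1 / (1 + q))"
    proof (intro mult_left_mono)
      have "(1 - q * (1 - a n)) * (1 + q) = 1 + q * a n - q\<^sup>2 * (1 - a n)"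
        by (simp add: algebra_simps power2_eq_square)
      also have "\<dots> \<le> 1 + q * a n" using an by simp
      finally have "(1 - q * (1 - a n)) * (1 + q) \<le> 1 * (1 + q * a n)" by simp
      moreover have "0 < 1 + q * a n" using an \<open>0 < q\<close> by (simp add: add_pos_nonneg)
      ultimately show "(1 - q * (1 - a n)) / (1 + q * a n) \<le> 1 / (1 + q)"
        using \<open>0 < q\<close> by (simp add: divide_le_eq le_divide_eq)
    qed (use an in simp)
    also have "\<dots> \<le> (1 / (1 + q)) ^ n * (a 0 / (1 - a 0)) * (1 / (1 + q))"
      using Suc \<open>0 < q\<close> by (intro mult_right_mono) auto
    finally show ?case
      using Suc \<open>a (Suc n) \<le> c\<close> \<open>c \<le> a n\<close> by (simp add: mult_ac)
  qed simp
  moreover have "a n \<le> a n / (1 - a n)"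
    using calculation nonneg[of n] \<open>a 0 < 1\<close>
    by (simp add: le_divide_eq) (simp add: algebra_simps)
  ultimately show ?thesis by linarith
qed

theorem theorem4p2:
  fixes E :: "real^'n \<Rightarrow> real" and xs :: "real^'n"
    and x v :: "nat \<Rightarrow> real^'n" and \<beta> :: "nat \<Rightarrow> real"
    and \<delta> M \<mu> L :: real
  assumes "twice_differentiable E"
    and "nondeg_index1_saddle E xs"
    and "\<delta> > 0"
    and "x 0 \<in> ball xs \<delta>"
    and "M > 0"
    and "\<And>y z. y \<in> ball xs \<delta> \<Longrightarrow> z \<in> ball xs \<delta> \<Longrightarrow>
           onorm ((*v) (hess E y - hess E z)) \<le> M * norm (y - z)"
    and "0 < \<mu>" and "\<mu> < L"
    and "\<And>y. y \<in> ball xs \<delta> \<Longrightarrow> eigvals (hess E y) ! 0 < 0"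
    and "\<And>y i. y \<in> ball xs \<delta> \<Longrightarrow> 1 \<le> i \<Longrightarrow> i < CARD('n) \<Longrightarrow>
           0 < eigvals (hess E y) ! i"
    and "\<And>y i. y \<in> ball xs \<delta> \<Longrightarrow> i < CARD('n) \<Longrightarrow>
           \<bar>eigvals (hess E y) ! i\<bar> \<in> {\<mu>..L}"
    and "\<And>n. norm (v n) = 1"
    and "\<And>n. hess E (x n) *v v n = (eigvals (hess E (x n)) ! 0) *\<^sub>R v n"
    and "norm (x 0 - xs) < min \<delta> (2 * \<mu> / M)"
    and "\<And>n. \<beta> n = 2 / (L + \<mu>)"
    and "\<And>n. x (Suc n) = x n - \<beta> n *\<^sub>R ((mat 1 - 2 *\<^sub>R outer (v n) (v n)) *v grad E (x n))"
  shows "x \<longlonglongrightarrow> xs \<and>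
    (let \<kappa> = L / \<mu>; r_hat = 2 * \<mu> / M; r = (\<lambda>n. norm (x n - xs))
     in \<forall>n. r n \<le> (1 - 2 / (\<kappa> + 3)) ^ n * (r_hat * r 0 / (r_hat - r 0)))"
proof -
  note M = \<open>M > 0\<close> and mu = \<open>0 < \<mu>\<close> \<open>\<mu> < L\<close>
  define radius where "radius = 2 * \<mu> / M"
  define q where "q = 2 * \<mu> / (L + \<mu>)"
  \<comment> \<open>measured in units of the admissible radius, the error obeys a recursion whose repelling fixed point is 1\<close>
  define a where "a n = norm (x n - xs) / radius" for n
  have "0 < radius" using M mu by (simp add: radius_def)
  have q: "0 < q" "q < 1" using mu by (simp_all add: q_def)
  have grad: "GDERIV E y :> grad E y" for y
    using assms(1) by (simp add: twice_differentiable_def differentiable_imp_GDERIV_grad)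
  have hess: "(grad E has_derivative (\<lambda>h. hess E y *v h)) (at y)" for y
    using assms(1) unfolding twice_differentiable_def hess_def by (metis jacobian_works)
  have sym: "(hess E y *v h) \<bullet> k = h \<bullet> (hess E y *v k)" for y h k
    using second_derivative_symmetric[OF grad hess] .
  have "grad E xs = 0"
    using assms(2) by (simp add: nondeg_index1_saddle_def)
  have step: "a (Suc n) \<le> a n * (1 - q * (1 - a n))" if "a n \<le> a 0" for n
  proof -
    let ?H = "hess E (x n)" and ?e = "x n - xs" and ?b = "2 / (L + \<mu>)"
    have "norm ?e \<le> norm (x 0 - xs)"
      using that \<open>0 < radius\<close> by (simp add: a_def divide_le_cancel)
    then have ball: "x n \<in> ball xs \<delta>"
      using assms(14) by (simp add: dist_norm norm_minus_commute)
    define \<rho> where "\<rho> = grad E xs - grad E (x n) - ?H *v (xs - x n)"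
    have "norm \<rho> \<le> M / 2 * (norm (xs - x n))\<^sup>2"
      unfolding \<rho>_def
    proof (rule taylor_remainder_bound[where S = "ball xs \<delta>" and H = "\<lambda>w h. hess E w *v h"])
      show "norm (hess E w *v h - ?H *v h) \<le> M * norm (w - x n) * norm h"
        if "w \<in> ball xs \<delta>" for w h
      proof -
        have "norm ((hess E w - ?H) *v h) \<le> onorm ((*v) (hess E w - ?H)) * norm h"
          by (rule onorm[OF matrix_vector_mul_bounded_linear])
        also have "\<dots> \<le> M * norm (w - x n) * norm h"
          by (intro mult_right_mono assms(6) that ball) simp
        finally show ?thesis by (simp add: matrix_vector_mult_diff_rdistrib)
      qed
    qed (use ball \<open>\<delta> > 0\<close> hess in auto)
    then have \<rho>: "norm \<rho> \<le> M / 2 * (norm ?e)\<^sup>2"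
      by (simp add: norm_minus_commute)
    have "grad E (x n) = ?H *v ?e - \<rho>"
      using \<open>grad E xs = 0\<close> by (simp add: \<rho>_def matrix_vector_mult_diff_distrib)
    then have "reflect (v n) (grad E (x n)) = reflect (v n) (?H *v ?e) - reflect (v n) \<rho>"
      by (simp only: linear_diff[OF linear_reflect])
    moreover have "x (Suc n) = x n - ?b *\<^sub>R reflect (v n) (grad E (x n))"
      by (simp only: assms(15,16) mat_minus_outer_mult)
    ultimately have "x (Suc n) - xs = (?e - ?b *\<^sub>R reflect (v n) (?H *v ?e)) + ?b *\<^sub>R reflect (v n) \<rho>"
      by (simp add: scaleR_diff_right)
    also have "norm \<dots> \<le> norm (?e - ?b *\<^sub>R reflect (v n) (?H *v ?e)) + ?b * norm \<rho>"
      by (rule norm_triangle_le) (use mu in \<open>simp add: norm_reflect assms(12)\<close>)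
    also have "\<dots> \<le> (L - \<mu>) / (L + \<mu>) * norm ?e + ?b * (M / 2 * (norm ?e)\<^sup>2)"
    proof (rule add_mono)
      show "norm (?e - ?b *\<^sub>R reflect (v n) (?H *v ?e)) \<le> (L - \<mu>) / (L + \<mu>) * norm ?e"
        by (rule reflected_step_contracts[OF sym assms(12,13) assms(9)[OF ball]
            assms(10)[OF ball] assms(11)[OF ball] mu])
      show "?b * norm \<rho> \<le> ?b * (M / 2 * (norm ?e)\<^sup>2)"
        using \<rho> mu by (intro mult_left_mono) auto
    qed
    finally have "norm (x (Suc n) - xs) \<le> (L - \<mu>) / (L + \<mu>) * norm ?e + ?b * (M / 2 * (norm ?e)\<^sup>2)" .
    then have "a (Suc n) \<le> ((L - \<mu>) / (L + \<mu>) * norm ?e + ?b * (M / 2 * (norm ?e)\<^sup>2)) / radius"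
      unfolding a_def using \<open>0 < radius\<close> by (intro divide_right_mono) auto
    also have "\<dots> = ((L - \<mu>) / (L + \<mu>)) * a n + (?b * (M / 2) * radius) * (a n)\<^sup>2"
      using \<open>0 < radius\<close> by (simp add: a_def add_divide_distrib power2_eq_square)
    also have "(L - \<mu>) / (L + \<mu>) = 1 - q"
      using mu by (simp add: q_def field_simps)
    also have "?b * (M / 2) * radius = q"
    proof -
      have "M / 2 * radius = \<mu>" using M by (simp add: radius_def)
      then have "?b * (M / 2) * radius = ?b * \<mu>" by (simp only: mult.assoc)
      then show ?thesis by (simp add: q_def)
    qed
    finally show ?thesis
      by (simp add: algebra_simps power2_eq_square)
  qed
  have "a 0 < 1"
    using assms(14) \<open>0 < radius\<close> by (simp add: a_def radius_def[symmetric])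
  have "1 / (1 + q) = 1 - 2 / (L / \<mu> + 3)"
  proof -
    have "1 + q = (L + 3 * \<mu>) / (L + \<mu>)" "L / \<mu> + 3 = (L + 3 * \<mu>) / \<mu>"
      using mu by (simp_all add: q_def field_simps)
    then have "1 / (1 + q) = (L + \<mu>) / (L + 3 * \<mu>)" "2 / (L / \<mu> + 3) = 2 * \<mu> / (L + 3 * \<mu>)"
      by simp_all
    moreover have "1 - 2 * \<mu> / (L + 3 * \<mu>) = (L + \<mu>) / (L + 3 * \<mu>)"
      using mu by (simp add: field_simps)
    ultimately show ?thesis by simp
  qed
  then have rate: "a n \<le> (1 - 2 / (L / \<mu> + 3)) ^ n * (a 0 / (1 - a 0))" for n
    using quadratic_recursion_bound[OF q _ \<open>a 0 < 1\<close> step, of n] \<open>0 < radius\<close> by (simp add: a_def)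
  have bound: "norm (x n - xs) \<le> (1 - 2 / (L / \<mu> + 3)) ^ n * (radius * norm (x 0 - xs) / (radius - norm (x 0 - xs)))" for n
  proof -
    have "norm (x n - xs) = radius * a n" using \<open>0 < radius\<close> by (simp add: a_def)
    also have "\<dots> \<le> radius * ((1 - 2 / (L / \<mu> + 3)) ^ n * (a 0 / (1 - a 0)))"
      using rate \<open>0 < radius\<close> by (intro mult_left_mono) auto
    also have "a 0 / (1 - a 0) = norm (x 0 - xs) / (radius - norm (x 0 - xs))"
      using \<open>0 < radius\<close> \<open>a 0 < 1\<close> by (simp add: a_def field_simps)
    finally show ?thesis by (simp add: mult_ac)
  qed
  have "\<bar>1 - 2 / (L / \<mu> + 3)\<bar> < 1"
    unfolding \<open>1 / (1 + q) = 1 - 2 / (L / \<mu> + 3)\<close>[symmetric] using q by simp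
  then have "(\<lambda>n. (1 - 2 / (L / \<mu> + 3)) ^ n * (radius * norm (x 0 - xs) / (radius - norm (x 0 - xs)))) \<longlonglongrightarrow> 0"
    by (intro tendsto_mult_left_zero LIMSEQ_power_zero) simp
  then have "(\<lambda>n. x n - xs) \<longlonglongrightarrow> 0"
    by (rule Lim_null_comparison[OF always_eventually[OF allI[OF bound]]])
  then have "x \<longlonglongrightarrow> xs"
    by (simp add: LIM_zero_iff)
  with bound show ?thesis
    by (simp add: Let_def radius_def)
qed

end
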